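(* Let $t>s\ge 3$ be integers. For all sufficiently large $n$: (i) if $s\ge 3$ is odd, then $r\!\left(K_{n,n},K_{s,t},st-\lfloor s/2\rfloor\right)=n^2-\lfloor n/2\rfloor$; (ii) if $s\ge 10$ is even, then $r\!\left(K_{n,n},K_{s,t},st-\lfloor s/2\rfloor\right)=n^2-\lceil n/2\rceil$.
   Context: For graphs $G,H$ and an integer $q$ with $2\le q\le |E(H)|$, an $(H,q)$-coloring of $G$ is an edge-coloring of $G$ in which every subgraph of $G$ isomorphic to $H$ receives at least $q$ distinct colors; $r(G,H,q)$ is the minimum number of colors needed for $G$ to have an $(H,q)$-coloring. $K_{n,n}$, $K_{s,t}$ denote complete bipartite graphs. *)

theory Defs
  imports Complex_Main
begin

record 'a graph =
  verts :: "'a set"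
  edges :: "'a set set"

definition simple_graph :: "'a graph \<Rightarrow> bool" where
  "simple_graph G \<longleftrightarrow> (\<forall>e \<in> edges G. e \<subseteq> verts G \<and> card e = 2)"

definition subgraph :: "'a graph \<Rightarrow> 'a graph \<Rightarrow> bool" where
  "subgraph H G \<longleftrightarrow> simple_graph H \<and> verts H \<subseteq> verts G \<and> edges H \<subseteq> edges G"

definition isomorphic :: "'a graph \<Rightarrow> 'b graph \<Rightarrow> bool" where
  "isomorphic G H \<longleftrightarrow>
     (\<exists>f. bij_betw f (verts G) (verts H) \<and>
          (\<forall>u \<in> verts G. \<forall>v \<in> verts G. {u, v} \<in> edges G \<longleftrightarrow> {f u, f v} \<in> edges H))"

definition complete_bipartite :: "nat \<Rightarrow> nat \<Rightarrow> (nat + nat) graph" where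
  "complete_bipartite m n =
     \<lparr>verts = {..<m} <+> {..<n}, edges = {{Inl i, Inr j} | i j. i < m \<and> j < n}\<rparr>"

text \<open>Edge-colorings need not be proper. Subgraphs are not required to be induced.\<close>

definition HQ_coloring :: "'a graph \<Rightarrow> 'b graph \<Rightarrow> nat \<Rightarrow> ('a set \<Rightarrow> nat) \<Rightarrow> bool" where
  "HQ_coloring G H q c \<longleftrightarrow>
     (\<forall>H'. subgraph H' G \<and> isomorphic H' H \<longrightarrow> q \<le> card (c ` edges H'))"

text \<open>The minimum is over a nonempty set whenever \<open>G\<close> has finitely many edges and \<open>q\<close> is at most the
  number of edges of the simple graph \<open>H\<close>; see \<open>HQ_coloring_exists\<close> below.\<close>

definition gen_ramsey :: "'a graph \<Rightarrow> 'b graph \<Rightarrow> nat \<Rightarrow> nat" where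
  "gen_ramsey G H q = (LEAST k. \<exists>c. HQ_coloring G H q c \<and> card (c ` edges G) = k)"

lemma isomorphic_card_edges:
  assumes G: "simple_graph G" and H: "simple_graph H" and iso: "isomorphic G H"
  shows "card (edges G) = card (edges H)"
proof -
  obtain f where f: "bij_betw f (verts G) (verts H)"
    and e: "\<And>u v. u \<in> verts G \<Longrightarrow> v \<in> verts G \<Longrightarrow> {u, v} \<in> edges G \<longleftrightarrow> {f u, f v} \<in> edges H"
    using iso unfolding isomorphic_def by blast
  have "inj_on ((`) f) (edges G)"
    using G f unfolding simple_graph_def bij_betw_def
    by (intro inj_onI) (metis inj_on_image_eq_iff)
  moreover have "(`) f ` edges G = edges H"
  proof (intro equalityI subsetI)
    fix x assume "x \<in> (`) f ` edges G"
    then obtain d where d: "d \<in> edges G" "x = f ` d" by blast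
    then obtain u v where uv: "d = {u, v}" using G unfolding simple_graph_def by (metis card_2_iff)
    then show "x \<in> edges H" using d e[of u v] G unfolding simple_graph_def by auto
  next
    fix x assume x: "x \<in> edges H"
    then obtain a b where ab: "x = {a, b}" using H unfolding simple_graph_def by (metis card_2_iff)
    then have "a \<in> verts H" "b \<in> verts H" using x H unfolding simple_graph_def by auto
    then obtain u v where "u \<in> verts G" "v \<in> verts G" "a = f u" "b = f v"
      using f unfolding bij_betw_def by blast
    then show "x \<in> (`) f ` edges G" using e[of u v] x ab by (auto intro!: image_eqI[of _ _ "{u, v}"])
  qed
  ultimately show ?thesis by (metis card_image)
qed

lemma HQ_coloring_exists:
  fixes G :: "'a graph" and H :: "'b graph"
  assumes "finite (edges G)" and H: "simple_graph H" and q: "q \<le> card (edges H)"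
  shows "\<exists>c. HQ_coloring G H q c"
proof -
  obtain c :: "'a set \<Rightarrow> nat" where c: "inj_on c (edges G)"
    using assms(1) finite_imp_inj_to_nat_seg by blast
  have "HQ_coloring G H q c"
    unfolding HQ_coloring_def subgraph_def
    using q H isomorphic_card_edges card_image c inj_on_subset by metis
  then show ?thesis by blast
qed

end

theory Submission
  imports Defs
begin

text \<open>
  Call \<open>|F| - |c(F)|\<close> the deficiency of an edge set \<open>F\<close>. Choosing one representative edge per
  color, a coloring of deficiency \<open>D\<close> has \<open>D\<close> units, each consisting of an edge and the distinct
  representative of its color; a grid containing \<open>p\<close> units has deficiency at least \<open>p\<close>. A unit
  occupies at most two rows and two columns, so when \<open>2D\<close> exceeds \<open>n\<close> some units must collide in
  rows and columns. Each collision involves at most two units and saves one row (or column), so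
  \<open>p = s div 2 + 1\<close> units fit into an \<open>s \<times> t\<close> grid: one saved row suffices for odd \<open>s\<close>, while
  two rows and one column must be saved for even \<open>s\<close>, which involves up to 6 units and hence needs
  \<open>s \<ge> 10\<close>. For the matching colorings, merge the colors of a perfect matching in pairs, with one
  triple if \<open>s\<close> is even and \<open>n\<close> is odd; the \<open>s\<close> side of a copy of \<open>K\<^sub>s\<^sub>,\<^sub>t\<close> covers its edges, so the
  copy contains at most \<open>s\<close> matching edges.
\<close>

section \<open>Colliding units and deficient subgrids\<close>

text \<open>With one representative kept per value, \<open>K\<close> is drawn from the remaining
  points and \<open>r\<close> sends a point to its representative. This is applied to colors of
  edges and to rows or columns of units.\<close>

lemma exists_duplicates:
  assumes "finite P" and "card (f ` P) + k \<le> card P"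
  shows "\<exists>K r. K \<subseteq> P \<and> card K = k \<and> r ` K \<subseteq> P - K \<and> (\<forall>x\<in>K. f (r x) = f x)"
proof -
  obtain R where R: "R \<subseteq> P" "inj_on f R" "f ` P = f ` R"
    using subset_image_inj[of "f ` P" f P] by auto
  have "card (P - R) = card P - card (f ` P)"
    using R assms(1) by (metis card_Diff_subset card_image finite_subset)
  then have "k \<le> card (P - R)" using assms(2) by linarith
  then obtain K where K: "K \<subseteq> P - R" "card K = k" by (meson obtain_subset_with_card_n)
  have "\<forall>x\<in>K. \<exists>y\<in>R. f y = f x" using K(1) R(3) by (metis DiffD1 image_iff subsetD)
  then obtain r where r: "\<forall>x\<in>K. r x \<in> R \<and> f (r x) = f x" by metis
  then have "K \<subseteq> P \<and> card K = k \<and> r ` K \<subseteq> P - K \<and> (\<forall>x\<in>K. f (r x) = f x)"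
    using K R(1) by auto
  then show ?thesis by blast
qed

text \<open>Deleting \<open>K\<close> loses no value, because each \<open>r x\<close> survives the
  deletion and has the value of \<open>x\<close>.\<close>

lemma card_image_duplicates:
  assumes "finite X" and "K \<subseteq> X" and "r ` K \<subseteq> X - K" and "\<And>x. x \<in> K \<Longrightarrow> f (r x) = f x"
  shows "card (f ` X) + card K \<le> card X"
proof -
  have "f x \<in> f ` (X - K)" if "x \<in> X" for x
  proof (cases "x \<in> K")
    case True
    then have "r x \<in> X - K" "f x = f (r x)" using assms(3,4) by auto
    then show ?thesis by (rule rev_image_eqI)
  qed (use that in auto)
  then have "f ` X \<subseteq> f ` (X - K)" by blast
  then have "card (f ` X) \<le> card (X - K)"
    using assms(1) by (meson card_image_le card_mono finite_Diff finite_imageI order_trans)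
  moreover have "card (X - K) = card X - card K"
    using assms(1,2) by (meson card_Diff_subset finite_subset)
  moreover have "card K \<le> card X" using assms(1,2) by (rule card_mono)
  ultimately show ?thesis by linarith
qed

text \<open>Here \<open>g\<close> and \<open>h\<close> give the rows (or columns) of the two edges
  of a unit. The \<open>2 * card U\<close> slots exceed \<open>Y\<close> by at least
  \<open>k\<close>, so \<open>k\<close> slots repeat others; each repetition involves at most two
  units, and \<open>W\<close> collects them.\<close>

lemma few_colliding_units:
  fixes g h :: "'u \<Rightarrow> 'v"
  assumes "finite U" and "finite Y" and "g ` U \<union> h ` U \<subseteq> Y" and "card Y + k \<le> 2 * card U"
  shows "\<exists>W\<subseteq>U. card W \<le> 2 * k \<and>
    (\<forall>V. finite V \<and> W \<subseteq> V \<longrightarrow> card (g ` V \<union> h ` V) + k \<le> 2 * card V)"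
proof -
  \<comment> \<open>Slots are tagged by a Boolean, so two edges of one unit in the same row also
    count as a collision.\<close>
  define f where "f = (\<lambda>(u, b). if b then g u else h u)"
  have img: "f ` (V \<times> UNIV) = g ` V \<union> h ` V" for V
    unfolding f_def UNIV_bool by force
  have cardP: "card (V \<times> (UNIV :: bool set)) = 2 * card V" for V :: "'u set"
    by (simp add: card_cartesian_product)
  have "card (f ` (U \<times> UNIV)) + k \<le> card (U \<times> (UNIV :: bool set))"
    using card_mono[OF assms(2,3)] assms(4) unfolding img cardP by linarith
  then obtain K r where K: "K \<subseteq> U \<times> UNIV" "card K = k" "r ` K \<subseteq> U \<times> UNIV - K"
      "\<forall>x\<in>K. f (r x) = f x"
    using exists_duplicates[of "U \<times> UNIV" f k] assms(1) by auto
  have finK: "finite K" using K(1) assms(1) by (meson finite_SigmaI finite finite_subset)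
  define W where "W = fst ` (K \<union> r ` K)"
  have "W \<subseteq> U" using K(1,3) unfolding W_def by auto
  moreover have "card W \<le> 2 * k"
  proof -
    have "card W \<le> card (K \<union> r ` K)" unfolding W_def using finK by (simp add: card_image_le)
    also have "\<dots> \<le> card K + card (r ` K)" by (rule card_Un_le)
    also have "\<dots> \<le> 2 * k" using card_image_le[OF finK, of r] K(2) by linarith
    finally show ?thesis .
  qed
  moreover have "card (g ` V \<union> h ` V) + k \<le> 2 * card V" if V: "finite V" "W \<subseteq> V" for V
  proof -
    have "K \<union> r ` K \<subseteq> V \<times> UNIV"
    proof
      fix x assume "x \<in> K \<union> r ` K"
      then have "fst x \<in> V" using V(2) unfolding W_def by blast
      then show "x \<in> V \<times> UNIV" by (cases x) auto
    qed
    then have "card (f ` (V \<times> UNIV)) + card K \<le> card (V \<times> (UNIV :: bool set))"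
      using V(1) K(3,4) by (intro card_image_duplicates[where r = r]) auto
    then show ?thesis unfolding img cardP K(2) .
  qed
  ultimately show ?thesis by blast
qed

text \<open>The aim is to choose \<open>p\<close> units that save \<open>k\<close> rows and
  \<open>l\<close> columns. They occupy at most \<open>2 * p - k\<close> rows and
  \<open>2 * p - l\<close> columns, which can be enlarged to exactly \<open>a\<close> and
  \<open>b\<close>.\<close>

lemma deficient_subgrid:
  fixes d :: "nat \<times> nat \<Rightarrow> 'c"
  assumes D: "card (d ` ({..<n} \<times> {..<n})) + D \<le> n * n"
    and k: "n + k \<le> 2 * D" and l: "n + l \<le> 2 * D" and kl: "2 * k + 2 * l \<le> p" and p: "p \<le> D"
    and a: "2 * p \<le> a + k" "a \<le> n" and b: "2 * p \<le> b + l" "b \<le> n"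
  shows "\<exists>S T. S \<subseteq> {..<n} \<and> T \<subseteq> {..<n} \<and> card S = a \<and> card T = b \<and>
    card (d ` (S \<times> T)) + p \<le> a * b"
proof -
  let ?P = "{..<n} \<times> {..<n}"
  \<comment> \<open>A unit is \<open>u\<close> together with \<open>r u\<close>; different units may
    share \<open>r u\<close>.\<close>
  obtain U r where U: "U \<subseteq> ?P" "card U = D" "r ` U \<subseteq> ?P - U" "\<forall>x\<in>U. d (r x) = d x"
    using exists_duplicates[of ?P d D] D by auto
  have finU: "finite U" using U(1) by (meson finite_SigmaI finite_lessThan finite_subset)
  have rows: "fst ` U \<union> (fst \<circ> r) ` U \<subseteq> {..<n}" and cols: "snd ` U \<union> (snd \<circ> r) ` U \<subseteq> {..<n}"
    using U(1,3) by fastforce+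
  obtain W1 where W1: "W1 \<subseteq> U" "card W1 \<le> 2 * k"
      "\<And>V. finite V \<Longrightarrow> W1 \<subseteq> V \<Longrightarrow> card (fst ` V \<union> (fst \<circ> r) ` V) + k \<le> 2 * card V"
    using few_colliding_units[OF finU finite_lessThan rows, of k] k U(2) by auto
  obtain W2 where W2: "W2 \<subseteq> U" "card W2 \<le> 2 * l"
      "\<And>V. finite V \<Longrightarrow> W2 \<subseteq> V \<Longrightarrow> card (snd ` V \<union> (snd \<circ> r) ` V) + l \<le> 2 * card V"
    using few_colliding_units[OF finU finite_lessThan cols, of l] l U(2) by auto
  \<comment> \<open>All units responsible for the savings fit among the \<open>p\<close>; any
    further units added keep both savings.\<close>
  have "card (W1 \<union> W2) \<le> p" using card_Un_le[of W1 W2] W1(2) W2(2) kl by linarith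
  then obtain V where V: "W1 \<union> W2 \<subseteq> V" "V \<subseteq> U" "card V = p"
    using exists_subset_between[of "W1 \<union> W2" p U] W1(1) W2(1) U(2) p finU by auto
  have finV: "finite V" using V(2) finU by (rule finite_subset)
  obtain S where S: "fst ` V \<union> (fst \<circ> r) ` V \<subseteq> S" "S \<subseteq> {..<n}" "card S = a"
  proof -
    have "card (fst ` V \<union> (fst \<circ> r) ` V) \<le> a" using W1(3)[OF finV] V a by auto
    moreover have "fst ` V \<union> (fst \<circ> r) ` V \<subseteq> {..<n}" using rows V(2) by blast
    ultimately show thesis
      using exists_subset_between[of "fst ` V \<union> (fst \<circ> r) ` V" a "{..<n}"] a(2) that by auto
  qed
  obtain T where T: "snd ` V \<union> (snd \<circ> r) ` V \<subseteq> T" "T \<subseteq> {..<n}" "card T = b"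
  proof -
    have "card (snd ` V \<union> (snd \<circ> r) ` V) \<le> b" using W2(3)[OF finV] V b by auto
    moreover have "snd ` V \<union> (snd \<circ> r) ` V \<subseteq> {..<n}" using cols V(2) by blast
    ultimately show thesis
      using exists_subset_between[of "snd ` V \<union> (snd \<circ> r) ` V" b "{..<n}"] b(2) that by auto
  qed
  have "V \<subseteq> S \<times> T" and "r ` V \<subseteq> S \<times> T"
    using S(1) T(1) by (auto simp: image_subset_iff mem_Times_iff)
  have "card (d ` (S \<times> T)) + card V \<le> card (S \<times> T)"
  proof (rule card_image_duplicates[where r = r])
    show "finite (S \<times> T)" using S(2) T(2) by (meson finite_SigmaI finite_lessThan finite_subset)
    show "r ` V \<subseteq> S \<times> T - V" using \<open>r ` V \<subseteq> S \<times> T\<close> U(3) V(2) by blast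
  qed (use \<open>V \<subseteq> S \<times> T\<close> U(4) V(2) in auto)
  then have "card (d ` (S \<times> T)) + p \<le> a * b"
    using V(3) S(3) T(3) by (simp add: card_cartesian_product)
  then show ?thesis using S T by blast
qed

section \<open>Copies of complete bipartite graphs as grids, and the lower bound\<close>

text \<open>Cells of a grid encode edges: rows are vertices of the left side, columns of the
  right.\<close>

definition grid_edge :: "'a \<times> 'b \<Rightarrow> ('a + 'b) set" where
  "grid_edge p = {Inl (fst p), Inr (snd p)}"

lemma inj_grid_edge: "inj grid_edge"
  unfolding grid_edge_def by (auto intro!: injI simp: doubleton_eq_iff prod_eq_iff)

lemma edges_complete_bipartite:
  "edges (complete_bipartite m n) = grid_edge ` ({..<m} \<times> {..<n})"
  unfolding complete_bipartite_def grid_edge_def by force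

lemma finite_edges_complete_bipartite: "finite (edges (complete_bipartite m n))"
  unfolding edges_complete_bipartite by simp

lemma card_edges_complete_bipartite: "card (edges (complete_bipartite m n)) = m * n"
  unfolding edges_complete_bipartite
  by (simp add: card_image inj_on_subset[OF inj_grid_edge] card_cartesian_product)

lemma simple_graph_complete_bipartite: "simple_graph (complete_bipartite m n)"
  unfolding simple_graph_def complete_bipartite_def by auto

lemma HQ_coloring_subgrid:
  assumes c: "HQ_coloring (complete_bipartite n n) (complete_bipartite s t) q c"
    and S: "S \<subseteq> {..<n}" "card S = s" and T: "T \<subseteq> {..<n}" "card T = t"
  shows "q \<le> card ((c \<circ> grid_edge) ` (S \<times> T))"
proof -
  define H :: "(nat + nat) graph" where "H = \<lparr>verts = S <+> T, edges = grid_edge ` (S \<times> T)\<rparr>"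
  have "subgraph H (complete_bipartite n n)"
    using S T unfolding subgraph_def simple_graph_def edges_complete_bipartite
    by (auto simp: H_def grid_edge_def complete_bipartite_def)
  moreover have "isomorphic H (complete_bipartite s t)"
  proof -
    have "finite S" "finite T" using S(1) T(1) by (auto intro: finite_subset)
    then obtain f g where f: "bij_betw f S {..<s}" and g: "bij_betw g T {..<t}"
      using S(2) T(2) by (metis ex_bij_betw_finite_nat lessThan_atLeast0)
    have fS: "f x < s" if "x \<in> S" for x using f that by (auto simp: bij_betw_def)
    have gT: "g x < t" if "x \<in> T" for x using g that by (auto simp: bij_betw_def)
    have "bij_betw (map_sum f g) (S <+> T) ({..<s} <+> {..<t})"
      unfolding bij_betw_def
    proof
      show "inj_on (map_sum f g) (S <+> T)"
        using f g unfolding bij_betw_def by (auto intro!: inj_onI dest: inj_onD)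
      show "map_sum f g ` (S <+> T) = {..<s} <+> {..<t}"
        using f g unfolding bij_betw_def Plus_def image_Un image_image by (auto simp: image_image)
    qed
    moreover have "{u, v} \<in> edges H \<longleftrightarrow>
        {map_sum f g u, map_sum f g v} \<in> edges (complete_bipartite s t)"
      if "u \<in> S <+> T" "v \<in> S <+> T" for u v
      using that fS gT
      by (cases u; cases v)
        (auto simp: H_def complete_bipartite_def grid_edge_def doubleton_eq_iff image_iff)
    ultimately show ?thesis
      unfolding isomorphic_def
      by (intro exI[of _ "map_sum f g"]) (auto simp: H_def complete_bipartite_def)
  qed
  ultimately have "q \<le> card (c ` edges H)" using c unfolding HQ_coloring_def by blast
  then show ?thesis by (simp add: H_def image_comp)
qed

text \<open>A deficiency of at least \<open>D\<close> would yield an \<open>s\<close> by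
  \<open>t\<close> subgrid with at most \<open>s * t - p\<close> colors, one too few.\<close>

lemma HQ_coloring_card_ge:
  assumes c: "HQ_coloring (complete_bipartite n n) (complete_bipartite s t) (s * t + 1 - p) c"
    and "n + k \<le> 2 * D" "n + l \<le> 2 * D" "2 * k + 2 * l \<le> p" "p \<le> D" "0 < p"
    and "2 * p \<le> s + k" "s \<le> n" "2 * p \<le> t + l" "t \<le> n"
  shows "n\<^sup>2 < card (c ` edges (complete_bipartite n n)) + D"
proof (rule ccontr)
  let ?d = "c \<circ> grid_edge"
  assume "\<not> ?thesis"
  then have "card (?d ` ({..<n} \<times> {..<n})) + D \<le> n * n"
    by (simp add: edges_complete_bipartite image_comp power2_eq_square)
  from deficient_subgrid[OF this assms(2-5,7-10)] obtain S T
    where "S \<subseteq> {..<n}" "T \<subseteq> {..<n}" "card S = s" "card T = t"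
      and small: "card (?d ` (S \<times> T)) + p \<le> s * t"
    by blast
  then have "s * t + 1 - p \<le> card (?d ` (S \<times> T))" using HQ_coloring_subgrid[OF c] by blast
  then show False using small \<open>0 < p\<close> by linarith
qed

section \<open>Colorings that merge colors on a perfect matching\<close>

text \<open>Diagonal edges are pairwise disjoint, so picking from each an endpoint in the side of
  size \<open>s\<close> is injective. The argument covers both orientations of the copy.\<close>

lemma card_diagonal_edges_le:
  assumes "simple_graph H" and iso: "isomorphic H (complete_bipartite s t)"
  shows "card {i. grid_edge (i, i) \<in> edges H} \<le> s" (is "card ?I \<le> s")
proof -
  obtain f where f: "bij_betw f (verts H) ({..<s} <+> {..<t})"
    and e: "\<And>u v. u \<in> verts H \<Longrightarrow> v \<in> verts H \<Longrightarrow>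
      {u, v} \<in> edges H \<longleftrightarrow> {f u, f v} \<in> edges (complete_bipartite s t)"
    using iso unfolding isomorphic_def by (auto simp: complete_bipartite_def)
  have "\<exists>x\<in>{Inl i, Inr i} \<inter> verts H. f x \<in> Inl ` {..<s}" if "i \<in> ?I" for i
  proof -
    have i: "{Inl i, Inr i} \<in> edges H" using that by (simp add: grid_edge_def)
    then have iV: "Inl i \<in> verts H" "Inr i \<in> verts H"
      using assms(1) unfolding simple_graph_def by auto
    with i e have "{f (Inl i), f (Inr i)} \<in> edges (complete_bipartite s t)" by blast
    then obtain a b where "a < s" "{f (Inl i), f (Inr i)} = {Inl a, Inr b}"
      unfolding complete_bipartite_def by auto
    then have "f (Inl i) \<in> Inl ` {..<s} \<or> f (Inr i) \<in> Inl ` {..<s}"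
      unfolding doubleton_eq_iff by blast
    then show ?thesis using iV by blast
  qed
  then obtain x where x: "\<And>i. i \<in> ?I \<Longrightarrow> x i \<in> {Inl i, Inr i} \<inter> verts H \<and> f (x i) \<in> Inl ` {..<s}"
    by atomize_elim (rule choice, blast)
  have "inj_on (f \<circ> x) ?I"
  proof (rule inj_onI)
    fix i j assume ij: "i \<in> ?I" "j \<in> ?I" "(f \<circ> x) i = (f \<circ> x) j"
    then have "x i = x j" using x f unfolding bij_betw_def by (auto dest: inj_onD)
    then show "i = j" using x[OF ij(1)] x[OF ij(2)] by auto
  qed
  moreover have "(f \<circ> x) ` ?I \<subseteq> Inl ` {..<s}" using x by auto
  ultimately have "card ?I \<le> card (Inl ` {..<s} :: (nat + nat) set)"
    using card_inj_on_le finite_imageI[OF finite_lessThan] by blast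
  then show ?thesis by (simp add: card_image)
qed

lemma HQ_coloring_merged_matching:
  fixes g :: "nat \<Rightarrow> nat"
  assumes g: "\<And>i. i < n \<Longrightarrow> g i < n"
    and small: "\<And>I. I \<subseteq> {..<n} \<Longrightarrow> card I \<le> s \<Longrightarrow> card I \<le> card (g ` I) + m"
  shows "\<exists>c. HQ_coloring (complete_bipartite n n) (complete_bipartite s t) (s * t - m) c \<and>
    card (c ` edges (complete_bipartite n n)) + n = n\<^sup>2 + card (g ` {..<n})"
proof -
  let ?E = "edges (complete_bipartite n n)"
  define M :: "nat \<Rightarrow> (nat + nat) set" where "M i = grid_edge (i, i)" for i
  have injM: "inj M" using inj_grid_edge unfolding M_def inj_def by blast
  have ME: "M i \<in> ?E \<longleftrightarrow> i < n" for i
    unfolding edges_complete_bipartite M_def inj_image_mem_iff[OF inj_grid_edge] by simp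
  \<comment> \<open>Colors are edges first: \<open>M i\<close> takes the color
    \<open>M (g i)\<close>, every other edge its own. Since \<open>enc\<close> is injective only on
    \<open>?E\<close>, \<open>h\<close> must stay inside \<open>?E\<close>, which the bound on
    \<open>g\<close> ensures.\<close>
  define h where "h e = (if e \<in> range M then M (g (inv M e)) else e)" for e
  have hM: "h (M i) = M (g i)" for i unfolding h_def using injM by simp
  have hE: "h e \<in> ?E" if "e \<in> ?E" for e
  proof (cases "e \<in> range M")
    case True
    then obtain i where "e = M i" by blast
    then show ?thesis using that g by (simp add: hM ME)
  qed (use that in \<open>simp add: h_def\<close>)
  obtain enc :: "(nat + nat) set \<Rightarrow> nat" where enc: "inj_on enc ?E"
    using finite_edges_complete_bipartite finite_imp_inj_to_nat_seg by blast
  define c where "c = enc \<circ> h"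
  \<comment> \<open>Stated without subtraction: the deficiency of \<open>c\<close> on
    \<open>F\<close> is that of \<open>g\<close> on the matching indices in
    \<open>F\<close>.\<close>
  have cnt: "card (c ` F) + card {i. M i \<in> F} = card F + card (g ` {i. M i \<in> F})"
    if F: "F \<subseteq> ?E" for F
  proof -
    let ?I = "{i. M i \<in> F}"
    have finF: "finite F" using F finite_edges_complete_bipartite by (rule finite_subset)
    have FI: "F \<inter> range M = M ` ?I" by auto
    have "h ` F \<subseteq> ?E" using F hE by auto
    then have "card (c ` F) = card (h ` F)"
      unfolding c_def image_comp[symmetric] by (intro card_image inj_on_subset[OF enc])
    also have "h ` F = (F - range M) \<union> M ` g ` ?I"
    proof -
      have "h ` F = h ` (F - range M) \<union> h ` (F \<inter> range M)" by blast
      also have "h ` (F - range M) = F - range M" by (auto simp: h_def)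
      also have "h ` (F \<inter> range M) = M ` g ` ?I" unfolding FI by (auto simp: image_image hM)
      finally show ?thesis .
    qed
    also have "card \<dots> = card (F - range M) + card (M ` g ` ?I)"
    proof (rule card_Un_disjoint)
      have "finite (M ` ?I)" unfolding FI[symmetric] using finF by simp
      then have "finite ?I" using injM by (simp add: finite_image_iff inj_on_subset)
      then show "finite (M ` g ` ?I)" by simp
    qed (use finF in auto)
    also have "card (M ` g ` ?I) = card (g ` ?I)"
      by (intro card_image inj_on_subset[OF injM]) simp
    finally have "card (c ` F) = card (F - range M) + card (g ` ?I)" .
    moreover have "card (F \<inter> range M) = card ?I"
      unfolding FI by (intro card_image inj_on_subset[OF injM]) simp
    moreover have "card F = card (F \<inter> range M) + card (F - range M)"
      using card_Int_Diff[OF finF] .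
    ultimately show ?thesis by linarith
  qed
  have "HQ_coloring (complete_bipartite n n) (complete_bipartite s t) (s * t - m) c"
    unfolding HQ_coloring_def
  proof (intro allI impI, elim conjE)
    fix H' assume sub: "subgraph H' (complete_bipartite n n)"
      and iso: "isomorphic H' (complete_bipartite s t)"
    let ?I = "{i. M i \<in> edges H'}"
    have simp_H': "simple_graph H'" and E: "edges H' \<subseteq> ?E" using sub by (auto simp: subgraph_def)
    have "card ?I \<le> s" using card_diagonal_edges_le[OF simp_H' iso] by (simp add: M_def)
    moreover have "?I \<subseteq> {..<n}" using E ME by auto
    ultimately have "card ?I \<le> card (g ` ?I) + m" using small by blast
    moreover have "card (edges H') = s * t"
      using isomorphic_card_edges[OF simp_H' simple_graph_complete_bipartite iso]
      by (simp add: card_edges_complete_bipartite)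
    ultimately show "s * t - m \<le> card (c ` edges H')" using cnt[OF E] by linarith
  qed
  moreover have "card (c ` ?E) + n = n\<^sup>2 + card (g ` {..<n})"
  proof -
    have "{i. M i \<in> ?E} = {..<n}" using ME by auto
    then show ?thesis
      using cnt[of ?E] by (simp add: card_edges_complete_bipartite power2_eq_square)
  qed
  ultimately show ?thesis by blast
qed

lemma card_le_twice_card_div2_image:
  fixes I :: "nat set"
  assumes "finite I"
  shows "card I \<le> 2 * card ((\<lambda>i. i div 2) ` I)"
proof -
  have "I \<subseteq> (\<lambda>(j, b). 2 * j + b) ` (((\<lambda>i. i div 2) ` I) \<times> {0, 1})"
  proof
    fix i assume "i \<in> I"
    then have "(i div 2, i mod 2) \<in> ((\<lambda>i. i div 2) ` I) \<times> {0, 1}" by auto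
    then show "i \<in> (\<lambda>(j, b). 2 * j + b) ` (((\<lambda>i. i div 2) ` I) \<times> {0, 1})"
      by (rule rev_image_eqI) simp
  qed
  then have "card I \<le> card (((\<lambda>i. i div 2) ` I) \<times> {0, 1 :: nat})"
    using assms by (intro surj_card_le) auto
  then show ?thesis by (simp add: card_cartesian_product)
qed

lemma image_div2_lessThan: "(\<lambda>i. i div 2) ` {..<n} = {..<(n + 1) div 2}" for n :: nat
proof
  show "{..<(n + 1) div 2} \<subseteq> (\<lambda>i. i div 2) ` {..<n}"
  proof
    fix j assume "j \<in> {..<(n + 1) div 2}"
    then show "j \<in> (\<lambda>i. i div 2) ` {..<n}" by (intro image_eqI[of _ _ "2 * j"]) auto
  qed
qed auto

section \<open>Exact values for odd and even \<open>s\<close>\<close>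

lemma gen_ramsey_eqI:
  assumes "HQ_coloring G H q c" "card (c ` edges G) = k"
    and "\<And>c. HQ_coloring G H q c \<Longrightarrow> k \<le> card (c ` edges G)"
  shows "gen_ramsey G H q = k"
  unfolding gen_ramsey_def using assms by (intro Least_equality) auto

lemma gen_ramsey_odd:
  assumes "3 \<le> s" "s < t" "t \<le> n" "odd s"
  shows "gen_ramsey (complete_bipartite n n) (complete_bipartite s t) (s * t - s div 2)
    = n\<^sup>2 - n div 2"
proof -
  have "\<exists>c. HQ_coloring (complete_bipartite n n) (complete_bipartite s t) (s * t - s div 2) c \<and>
    card (c ` edges (complete_bipartite n n)) + n = n\<^sup>2 + card ((\<lambda>i. i div 2) ` {..<n})"
  proof (rule HQ_coloring_merged_matching)
    fix I :: "nat set" assume I: "I \<subseteq> {..<n}" "card I \<le> s"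
    then have "card I \<le> 2 * card ((\<lambda>i. i div 2) ` I)"
      by (intro card_le_twice_card_div2_image finite_subset[OF I(1)]) simp
    then show "card I \<le> card ((\<lambda>i. i div 2) ` I) + s div 2" using I(2) by linarith
  qed auto
  then obtain c where c: "HQ_coloring (complete_bipartite n n) (complete_bipartite s t) (s * t - s div 2) c"
      "card (c ` edges (complete_bipartite n n)) + n = n\<^sup>2 + (n + 1) div 2"
    by (auto simp: image_div2_lessThan)
  show ?thesis
  proof (rule gen_ramsey_eqI[OF c(1)])
    show "card (c ` edges (complete_bipartite n n)) = n\<^sup>2 - n div 2" using c(2) by linarith
  next
    fix c assume c: "HQ_coloring (complete_bipartite n n) (complete_bipartite s t) (s * t - s div 2) c"
    \<comment> \<open>Now \<open>2 * p = s + 1\<close>: one row must be saved, while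
      \<open>s < t\<close> already leaves room for the columns. The value of \<open>D\<close> gives
      \<open>n + 1 \<le> 2 * D\<close>.\<close>
    have "n\<^sup>2 < card (c ` edges (complete_bipartite n n)) + (n div 2 + 1)"
    proof (rule HQ_coloring_card_ge[where s = s and t = t and p = "s div 2 + 1" and k = 1 and l = 0])
      show "2 * (s div 2 + 1) \<le> s + 1" using \<open>odd s\<close> by (auto elim!: oddE)
    qed (use c assms in auto)
    then show "n\<^sup>2 - n div 2 \<le> card (c ` edges (complete_bipartite n n))" by linarith
  qed
qed

lemma gen_ramsey_even:
  assumes "10 \<le> s" "s < t" "t \<le> n" "even s"
  shows "gen_ramsey (complete_bipartite n n) (complete_bipartite s t) (s * t - s div 2)
    = n\<^sup>2 - (n + 1) div 2"
proof -
  \<comment> \<open>The \<open>min\<close> puts the last index of an odd \<open>n\<close> into the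
    preceding pair, forming the triple; for even \<open>n\<close> it changes nothing below
    \<open>n\<close>.\<close>
  define g where "g i = min (i div 2) (n div 2 - 1)" for i
  have g_img: "g ` {..<n} = {..<n div 2}"
  proof
    show "g ` {..<n} \<subseteq> {..<n div 2}" using assms by (auto simp: g_def min_def)
    show "{..<n div 2} \<subseteq> g ` {..<n}"
    proof
      fix j assume "j \<in> {..<n div 2}"
      then show "j \<in> g ` {..<n}" by (intro image_eqI[of _ _ "2 * j"]) (auto simp: g_def)
    qed
  qed
  have "\<exists>c. HQ_coloring (complete_bipartite n n) (complete_bipartite s t) (s * t - s div 2) c \<and>
    card (c ` edges (complete_bipartite n n)) + n = n\<^sup>2 + card (g ` {..<n})"
  proof (rule HQ_coloring_merged_matching)
    show "g i < n" if "i < n" for i using that by (auto simp: g_def)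
  next
    fix I assume I: "I \<subseteq> {..<n}" "card I \<le> s"
    \<comment> \<open>Removing the possible third member of the triple leaves classes of size at
      most two.\<close>
    let ?J = "I - {2 * (n div 2)}"
    have finI: "finite I" using I(1) by (rule finite_subset) simp
    have "g ` ?J = (\<lambda>i. i div 2) ` ?J"
    proof (rule image_cong)
      fix i assume "i \<in> ?J"
      then have "i < n" "i \<noteq> 2 * (n div 2)" using I(1) by auto
      then have "i div 2 \<le> n div 2 - 1" by linarith
      then show "g i = i div 2" by (simp add: g_def)
    qed simp
    then have "card ?J \<le> 2 * card (g ` ?J)"
      using card_le_twice_card_div2_image[of ?J] finI by simp
    also have "\<dots> \<le> 2 * card (g ` I)" using finI by (simp add: card_mono image_mono)
    finally have "card I \<le> 2 * card (g ` I) + 1"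
      using diff_card_le_card_Diff[of "{2 * (n div 2)}" I] by simp
    \<comment> \<open>Evenness absorbs the extra 1: an odd \<open>card I\<close> is at most
      \<open>s - 1\<close>.\<close>
    then show "card I \<le> card (g ` I) + s div 2" using I(2) \<open>even s\<close> by (auto elim!: evenE)
  qed
  then obtain c where c: "HQ_coloring (complete_bipartite n n) (complete_bipartite s t) (s * t - s div 2) c"
      "card (c ` edges (complete_bipartite n n)) + n = n\<^sup>2 + n div 2"
    by (auto simp: g_img)
  show ?thesis
  proof (rule gen_ramsey_eqI[OF c(1)])
    show "card (c ` edges (complete_bipartite n n)) = n\<^sup>2 - (n + 1) div 2" using c(2) by linarith
  next
    fix c assume c: "HQ_coloring (complete_bipartite n n) (complete_bipartite s t) (s * t - s div 2) c"
    \<comment> \<open>Now \<open>2 * p = s + 2\<close>, so two rows are saved, and one column in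
      case \<open>t = s + 1\<close>. The condition \<open>2 * 2 + 2 * 1 \<le> s div 2 + 1\<close> is
      exactly where \<open>s \<ge> 10\<close> enters.\<close>
    have "n\<^sup>2 < card (c ` edges (complete_bipartite n n)) + ((n + 1) div 2 + 1)"
      by (rule HQ_coloring_card_ge[where s = s and t = t and p = "s div 2 + 1" and k = 2 and l = 1])
        (use c assms in auto)
    then show "n\<^sup>2 - (n + 1) div 2 \<le> card (c ` edges (complete_bipartite n n))" by linarith
  qed
qed

theorem theoremB2:
  fixes s t :: nat
  assumes "3 \<le> s" and "s < t"
  shows "\<exists>N. \<forall>n\<ge>N.
    (3 \<le> s \<and> odd s \<longrightarrow>
       gen_ramsey (complete_bipartite n n) (complete_bipartite s t) (s * t - s div 2)
         = n\<^sup>2 - n div 2) \<and>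
    (10 \<le> s \<and> even s \<longrightarrow>
       gen_ramsey (complete_bipartite n n) (complete_bipartite s t) (s * t - s div 2)
         = n\<^sup>2 - nat \<lceil>real n / 2\<rceil>)"
proof -
  have "nat \<lceil>real n / 2\<rceil> = (n + 1) div 2" for n
    by linarith
  \<comment> \<open>The threshold \<open>t\<close> makes both sides of the copy fit into
    \<open>n\<close> vertices.\<close>
  then show ?thesis using gen_ramsey_odd gen_ramsey_even assms(2) by (intro exI[of _ t]) auto
qed

end
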